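(* Let $G$ be a connected graph with vertex set $\{1,\dots,n\}$, $n\ge 2$, let $\Phi=(F_1,\dots,F_n)$ be an $n$-tuple of pairwise disjoint graphs, and let $G[\Phi]$ be the generalized lexicographic product. Let $D$ be a minimum dominating set of $G[\Phi]$ such that $|V(F_i)|\ge 2$ and $|D\cap V(F_i)|\ne 1$ for all $i\in[n]$. Let $F_{i_1},\dots,F_{i_s}$ be all the $F_i$ with $D\cap V(F_i)\neq\emptyset$. Then $|D\cap V(F_{i_r})|=2$ for all $r\in[s]$, $\{i_1,\dots,i_s\}$ is an efficient dominating set of $G$, and $2\gamma(G)=\gamma_t(G)=\gamma(G[\Phi])=\gamma_r(G[\Phi])=\gamma_t(G[\Phi])=\gamma_{tr}(G[\Phi])=\gamma^{oc}(G[\Phi])=\gamma_t^{oc}(G[\Phi])=\gamma_p(G[\Phi])$.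
   Context: All graphs are finite, simple and undirected; $[n]=\{1,\dots,n\}$. The generalized lexicographic product $G[\Phi]$ is the graph with vertex set $\bigcup_{i=1}^n V(F_i)$ in which each $F_i$ is an induced subgraph, and for $x\in V(F_i)$, $y\in V(F_j)$ with $i\neq j$, $xy$ is an edge iff $ij\in E(G)$. For a graph $H$ and $S\subseteq V(H)$: $S$ is dominating if every vertex outside $S$ has a neighbor in $S$; efficient dominating if every vertex of $H$ is dominated (i.e. equals or is adjacent to) exactly one vertex of $S$; total dominating if every vertex of $H$ has a neighbor in $S$; a dominating set $S$ is restrained if every vertex outside $S$ has a neighbor outside $S$, outer-connected if the subgraph induced by $V(H)\setminus S$ is connected, and paired if the subgraph induced by $S$ has a perfect matching. $\gamma,\gamma_t,\gamma_r,\gamma_{tr},\gamma^{oc},\gamma_t^{oc},\gamma_p$ denote the minimum cardinalities of, respectively, dominating, total dominating, restrained dominating, total restrained dominating (total and restrained), outer-connected dominating, total outer-connected dominating (total and outer-connected), and paired dominating sets. *)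

theory Defs
  imports "Graph_Theory.Digraph_Component" "HOL-Library.Extended_Nat"
begin

text \<open>
  A finite simple undirected graph is a \<^locale>\<open>pair_graph\<close>: a finite vertex set \<^const>\<open>pverts\<close>
  with a symmetric, irreflexive adjacency relation \<^const>\<open>parcs\<close>.
\<close>

definition lex_product ::
  "'i pair_pre_digraph \<Rightarrow> ('i \<Rightarrow> 'a pair_pre_digraph) \<Rightarrow> 'a pair_pre_digraph" where
  "lex_product G F = \<lparr>
     pverts = (\<Union>i\<in>pverts G. pverts (F i)),
     parcs = (\<Union>i\<in>pverts G. parcs (F i)) \<union>
             (\<Union>(i, j)\<in>parcs G. pverts (F i) \<times> pverts (F j)) \<rparr>"

definition dominating_set :: "'a pair_pre_digraph \<Rightarrow> 'a set \<Rightarrow> bool" where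
  "dominating_set H S \<longleftrightarrow>
     S \<subseteq> pverts H \<and> (\<forall>v \<in> pverts H - S. \<exists>u\<in>S. (v, u) \<in> parcs H)"

definition efficient_dominating_set :: "'a pair_pre_digraph \<Rightarrow> 'a set \<Rightarrow> bool" where
  "efficient_dominating_set H S \<longleftrightarrow>
     S \<subseteq> pverts H \<and> (\<forall>v \<in> pverts H. \<exists>!u. u \<in> S \<and> (v = u \<or> (v, u) \<in> parcs H))"

definition total_dominating_set :: "'a pair_pre_digraph \<Rightarrow> 'a set \<Rightarrow> bool" where
  "total_dominating_set H S \<longleftrightarrow>
     S \<subseteq> pverts H \<and> (\<forall>v \<in> pverts H. \<exists>u\<in>S. (v, u) \<in> parcs H)"

definition restrained_dominating_set :: "'a pair_pre_digraph \<Rightarrow> 'a set \<Rightarrow> bool" where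
  "restrained_dominating_set H S \<longleftrightarrow>
     dominating_set H S \<and> (\<forall>v \<in> pverts H - S. \<exists>u \<in> pverts H - S. (v, u) \<in> parcs H)"

definition total_restrained_dominating_set :: "'a pair_pre_digraph \<Rightarrow> 'a set \<Rightarrow> bool" where
  "total_restrained_dominating_set H S \<longleftrightarrow>
     total_dominating_set H S \<and> restrained_dominating_set H S"

text \<open>The library's notion of connectedness excludes the graph without vertices, so \<open>S\<close> is a proper
  subset of the vertex set here.\<close>

definition outer_connected_dominating_set :: "'a pair_pre_digraph \<Rightarrow> 'a set \<Rightarrow> bool" where
  "outer_connected_dominating_set H S \<longleftrightarrow>
     dominating_set H S \<and>
     Digraph_Component.connected (induce_subgraph (with_proj H) (pverts H - S))"

definition total_outer_connected_dominating_set :: "'a pair_pre_digraph \<Rightarrow> 'a set \<Rightarrow> bool" where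
  "total_outer_connected_dominating_set H S \<longleftrightarrow>
     total_dominating_set H S \<and> outer_connected_dominating_set H S"

text \<open>Undirected edges are unordered pairs, each represented by two opposite arcs of \<open>K\<close>.\<close>

definition perfect_matching :: "('a, 'b) pre_digraph \<Rightarrow> 'a set set \<Rightarrow> bool" where
  "perfect_matching K M \<longleftrightarrow>
     M \<subseteq> {{u, v} |u v. (u, v) \<in> arcs_ends K} \<and> (\<forall>v \<in> verts K. \<exists>!e. e \<in> M \<and> v \<in> e)"

definition paired_dominating_set :: "'a pair_pre_digraph \<Rightarrow> 'a set \<Rightarrow> bool" where
  "paired_dominating_set H S \<longleftrightarrow>
     dominating_set H S \<and> (\<exists>M. perfect_matching (induce_subgraph (with_proj H) S) M)"

text \<open>Minimum cardinality of a set with property \<open>P\<close>, for families of finite sets; the value is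
  \<open>\<infinity>\<close> if no such set exists.\<close>

definition min_card :: "('a set \<Rightarrow> bool) \<Rightarrow> enat" where
  "min_card P = (INF S \<in> {S. P S}. enat (card S))"

definition domination_number :: "'a pair_pre_digraph \<Rightarrow> enat" (\<open>\<gamma>\<close>) where
  "\<gamma> H = min_card (dominating_set H)"

definition total_domination_number :: "'a pair_pre_digraph \<Rightarrow> enat" (\<open>\<gamma>\<^sub>t\<close>) where
  "\<gamma>\<^sub>t H = min_card (total_dominating_set H)"

definition restrained_domination_number :: "'a pair_pre_digraph \<Rightarrow> enat" (\<open>\<gamma>\<^sub>r\<close>) where
  "\<gamma>\<^sub>r H = min_card (restrained_dominating_set H)"

definition total_restrained_domination_number :: "'a pair_pre_digraph \<Rightarrow> enat" (\<open>\<gamma>\<^sub>t\<^sub>r\<close>) where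
  "\<gamma>\<^sub>t\<^sub>r H = min_card (total_restrained_dominating_set H)"

definition outer_connected_domination_number :: "'a pair_pre_digraph \<Rightarrow> enat" (\<open>\<gamma>\<^sup>o\<^sup>c\<close>) where
  "\<gamma>\<^sup>o\<^sup>c H = min_card (outer_connected_dominating_set H)"

definition total_outer_connected_domination_number :: "'a pair_pre_digraph \<Rightarrow> enat" (\<open>\<gamma>\<^sub>t\<^sup>o\<^sup>c\<close>) where
  "\<gamma>\<^sub>t\<^sup>o\<^sup>c H = min_card (total_outer_connected_dominating_set H)"

definition paired_domination_number :: "'a pair_pre_digraph \<Rightarrow> enat" (\<open>\<gamma>\<^sub>p\<close>) where
  "\<gamma>\<^sub>p H = min_card (paired_dominating_set H)"

definition minimum_dominating_set :: "'a pair_pre_digraph \<Rightarrow> 'a set \<Rightarrow> bool" where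
  "minimum_dominating_set H S \<longleftrightarrow> dominating_set H S \<and> enat (card S) = \<gamma> H"

lemma lex_product_simps [simp]:
  "pverts (lex_product G F) = (\<Union>i\<in>pverts G. pverts (F i))"
  "parcs (lex_product G F) = (\<Union>i\<in>pverts G. parcs (F i)) \<union>
     (\<Union>(i, j)\<in>parcs G. pverts (F i) \<times> pverts (F j))"
  by (simp_all add: lex_product_def)

lemma lex_product_adjacent_iff:
  assumes "pair_graph G" "\<And>i. i \<in> pverts G \<Longrightarrow> pair_graph (F i)"
    and disj: "\<And>i j. i \<in> pverts G \<Longrightarrow> j \<in> pverts G \<Longrightarrow> i \<noteq> j \<Longrightarrow> pverts (F i) \<inter> pverts (F j) = {}"
    and ij: "i \<in> pverts G" "j \<in> pverts G" and xy: "x \<in> pverts (F i)" "y \<in> pverts (F j)"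
  shows "(x, y) \<in> parcs (lex_product G F) \<longleftrightarrow>
    (if i = j then (x, y) \<in> parcs (F i) else (i, j) \<in> parcs G)"
proof -
  interpret G: pair_graph G by fact
  have idx: "k = l" if "k \<in> pverts G" "l \<in> pverts G" "z \<in> pverts (F k)" "z \<in> pverts (F l)" for k l z
    using disj[of k l] that by blast
  have F: "x \<in> pverts (F k) \<and> y \<in> pverts (F k)" if "k \<in> pverts G" "(x, y) \<in> parcs (F k)" for k
  proof -
    interpret Fk: pair_graph "F k" using assms(2) that by simp
    show ?thesis using that Fk.in_arcsD1 Fk.in_arcsD2 by blast
  qed
  have G: "k \<in> pverts G \<and> l \<in> pverts G \<and> k \<noteq> l" if "(k, l) \<in> parcs G" for k l
    using that G.in_arcsD1 G.in_arcsD2 G.no_loops' by blast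
  have "(x, y) \<in> parcs (lex_product G F) \<longleftrightarrow>
    (\<exists>k\<in>pverts G. (x, y) \<in> parcs (F k)) \<or>
    (\<exists>k l. (k, l) \<in> parcs G \<and> x \<in> pverts (F k) \<and> y \<in> pverts (F l))"
    by auto
  also have "(\<exists>k\<in>pverts G. (x, y) \<in> parcs (F k)) \<longleftrightarrow> i = j \<and> (x, y) \<in> parcs (F i)"
    using F idx ij xy by metis
  also have "(\<exists>k l. (k, l) \<in> parcs G \<and> x \<in> pverts (F k) \<and> y \<in> pverts (F l)) \<longleftrightarrow> (i, j) \<in> parcs G"
    using G idx ij xy by metis
  finally show ?thesis using G by auto
qed

lemma pair_graph_lex_product:
  assumes "pair_graph G" and F: "\<And>i. i \<in> pverts G \<Longrightarrow> pair_graph (F i)"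
    and disj: "\<And>i j. i \<in> pverts G \<Longrightarrow> j \<in> pverts G \<Longrightarrow> i \<noteq> j \<Longrightarrow> pverts (F i) \<inter> pverts (F j) = {}"
  shows "pair_graph (lex_product G F)"
proof -
  interpret G: pair_graph G by fact
  have F1: "x \<in> pverts (F k) \<and> y \<in> pverts (F k) \<and> x \<noteq> y \<and> (y, x) \<in> parcs (F k)"
    if "k \<in> pverts G" "(x, y) \<in> parcs (F k)" for k x y
  proof -
    interpret Fk: pair_graph "F k" using F that by simp
    show ?thesis using that Fk.in_arcsD1 Fk.in_arcsD2 Fk.no_loops' Fk.arcs_symmetric by blast
  qed
  have F2: "finite (pverts (F k))" "finite (parcs (F k))" if "k \<in> pverts G" for k
    using F[OF that] by (simp_all add: pair_graph_def pair_digraph_def pair_fin_digraph_def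
        pair_fin_digraph_axioms_def)
  have G1: "k \<in> pverts G \<and> l \<in> pverts G \<and> k \<noteq> l \<and> (l, k) \<in> parcs G" if "(k, l) \<in> parcs G" for k l
    using that G.in_arcsD1 G.in_arcsD2 G.no_loops' G.arcs_symmetric by blast
  have arc_iff: "(x, y) \<in> parcs (lex_product G F) \<longleftrightarrow>
    (\<exists>k\<in>pverts G. (x, y) \<in> parcs (F k)) \<or>
    (\<exists>k l. (k, l) \<in> parcs G \<and> x \<in> pverts (F k) \<and> y \<in> pverts (F l))" for x y
    by auto
  have arc: "x \<in> pverts (lex_product G F) \<and> y \<in> pverts (lex_product G F) \<and> x \<noteq> y \<and>
      (y, x) \<in> parcs (lex_product G F)" if "(x, y) \<in> parcs (lex_product G F)" for x y
    using that[unfolded arc_iff]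
  proof
    assume "\<exists>k\<in>pverts G. (x, y) \<in> parcs (F k)"
    then show ?thesis unfolding arc_iff lex_product_simps(1) using F1 by blast
  next
    assume "\<exists>k l. (k, l) \<in> parcs G \<and> x \<in> pverts (F k) \<and> y \<in> pverts (F l)"
    then obtain k l where kl: "(k, l) \<in> parcs G" "x \<in> pverts (F k)" "y \<in> pverts (F l)" by blast
    then have "x \<noteq> y" using G1[OF kl(1)] disj[of k l] by blast
    then show ?thesis unfolding arc_iff lex_product_simps(1) using kl G1[OF kl(1)] by blast
  qed
  have fin: "finite (pverts (lex_product G F))" using F2 by simp
  have "parcs (lex_product G F) \<subseteq> pverts (lex_product G F) \<times> pverts (lex_product G F)"
    using arc by (intro subrelI) blast
  then have "finite (parcs (lex_product G F))" using fin finite_subset by blast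
  moreover have "symmetric (with_proj (lex_product G F))"
    unfolding symmetric_def with_proj_simps(3) using arc by (intro symI) blast
  ultimately show ?thesis
    using arc fin by unfold_locales (metis prod.collapse)+
qed

end

theory Submission
  imports Defs
begin

text \<open>
  If \<open>T\<close> is a total dominating set of \<open>G\<close>, any choice of one vertex from each \<open>F\<^sub>i\<close>, \<open>i \<in> T\<close>, is
  a total dominating set of \<open>G[\<Phi>]\<close>; adding a neighbour of each vertex to a dominating set \<open>S\<close> of \<open>G\<close>
  gives a total dominating set with at most \<open>2 * card S\<close> vertices; and \<open>I\<close> dominates \<open>G\<close>. Hence
  \<open>card D \<le> \<gamma>\<^sub>t G \<le> 2 * \<gamma> G \<le> 2 * card I \<le> card D\<close>, so equality holds throughout. Consequently, no
  choice of neighbours \<open>f i\<close> for \<open>i \<in> I\<close> can make \<open>I \<union> f ` I\<close> smaller than \<open>2 * card I\<close>, so \<open>f\<close> is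
  injective and \<open>f ` I\<close> is disjoint from \<open>I\<close>; this is efficiency of \<open>I\<close>. A transversal
  of the factors indexed by \<open>I \<union> f ` I\<close> has the perfect matching given by \<open>f\<close>, and since every factor
  keeps a vertex outside it, its complement inherits connectedness from \<open>G\<close>. This single set attains
  all seven parameters of \<open>G[\<Phi>]\<close>.
\<close>

section \<open>Minimum cardinalities and matchings\<close>

lemma min_card_eqI:
  assumes "P S" and "\<And>T. P T \<Longrightarrow> card S \<le> card T"
  shows "min_card P = enat (card S)"
  unfolding min_card_def
proof (rule antisym)
  show "(INF S\<in>{S. P S}. enat (card S)) \<le> enat (card S)"
    using assms(1) by (intro INF_lower) simp
  show "enat (card S) \<le> (INF S\<in>{S. P S}. enat (card S))"
    using assms(2) by (intro INF_greatest) simp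
qed

lemma min_card_le: "P S \<Longrightarrow> min_card P \<le> enat (card S)"
  unfolding min_card_def by (intro INF_lower) simp

lemma total_dominating_imp_dominating:
  "total_dominating_set H S \<Longrightarrow> dominating_set H S"
  unfolding total_dominating_set_def dominating_set_def by blast

lemma arcs_ends_induce_subgraph:
  "arcs_ends (induce_subgraph (with_proj H) S) = parcs H \<inter> S \<times> S"
  by (auto simp: arcs_ends_conv)

text \<open>Injectivity of \<open>g\<close> and of \<open>h\<close>, together with disjointness of
  their images, lets each vertex lie in the pair of a single index.\<close>

lemma perfect_matching_images:
  assumes "inj_on g A" "inj_on h A" "g ` A \<inter> h ` A = {}"
    and "\<And>i. i \<in> A \<Longrightarrow> (g i, h i) \<in> parcs H"
  shows "perfect_matching (induce_subgraph (with_proj H) (g ` A \<union> h ` A)) ((\<lambda>i. {g i, h i}) ` A)"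
  unfolding perfect_matching_def
proof (intro conjI ballI)
  show "(\<lambda>i. {g i, h i}) ` A
    \<subseteq> {{u, v} |u v. (u, v) \<in> arcs_ends (induce_subgraph (with_proj H) (g ` A \<union> h ` A))}"
    unfolding arcs_ends_induce_subgraph using assms(4) by blast
next
  fix v assume "v \<in> verts (induce_subgraph (with_proj H) (g ` A \<union> h ` A))"
  then obtain i where i: "i \<in> A" "v \<in> {g i, h i}" by auto
  have uniq: "j = i" if "j \<in> A" "v \<in> {g j, h j}" for j
    using that i assms(1-3) by (auto dest: inj_onD)
  show "\<exists>!e. e \<in> (\<lambda>i. {g i, h i}) ` A \<and> v \<in> e"
  proof (intro ex1I[of _ "{g i, h i}"] conjI)
    fix e assume "e \<in> (\<lambda>i. {g i, h i}) ` A \<and> v \<in> e"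
    then obtain j where "j \<in> A" "e = {g j, h j}" "v \<in> {g j, h j}" by blast
    then show "e = {g i, h i}" using uniq by blast
  qed (use i in blast)+
qed

section \<open>Connectedness and efficient domination in one graph\<close>

context pair_graph
begin

text \<open>\<open>connected\<close> refers to reachability in the symmetric closure; the arcs here
  are already symmetric, so the closure adds nothing.\<close>

lemma connected_iff_reachable:
  "Digraph_Component.connected (with_proj G) \<longleftrightarrow>
     pverts G \<noteq> {} \<and> (\<forall>u\<in>pverts G. \<forall>v\<in>pverts G. u \<rightarrow>\<^sup>*\<^bsub>with_proj G\<^esub> v)"
  unfolding Digraph_Component.connected_def strongly_connected_def
  using reachable_mk_symmetric_eq[OF sym_arcs] by simp

lemma connected_ex_neighbour:
  assumes "Digraph_Component.connected (with_proj G)" "card (pverts G) \<ge> 2" "v \<in> pverts G"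
  shows "\<exists>w. (v, w) \<in> parcs G"
proof -
  have "pverts G \<noteq> {v}" using assms(2) by auto
  then obtain w where "w \<in> pverts G" "w \<noteq> v" using assms(3) by blast
  moreover from this have "v \<rightarrow>\<^sup>*\<^bsub>with_proj G\<^esub> w"
    using assms connected_iff_reachable by blast
  ultimately show ?thesis
    by (auto elim: converse_reachable_cases)
qed

lemma total_dominating_set_Un_neighbours:
  assumes "dominating_set G S" and f: "\<And>v. v \<in> S \<Longrightarrow> (v, f v) \<in> parcs G"
  shows "total_dominating_set G (S \<union> f ` S)"
  unfolding total_dominating_set_def
proof (intro conjI ballI)
  show "S \<union> f ` S \<subseteq> pverts G"
    using assms in_arcsD2 unfolding dominating_set_def by blast
  show "\<exists>u\<in>S \<union> f ` S. (v, u) \<in> parcs G" if "v \<in> pverts G" for v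
    using assms that unfolding dominating_set_def by blast
qed

lemma efficient_dominating_setI:
  assumes dom: "dominating_set G S" and fin: "finite S"
    and nb: "\<And>v. v \<in> pverts G \<Longrightarrow> \<exists>w. (v, w) \<in> parcs G"
    and le: "\<And>T. total_dominating_set G T \<Longrightarrow> 2 * card S \<le> card T"
  shows "efficient_dominating_set G S"
proof -
  have sub: "S \<subseteq> pverts G" using dom unfolding dominating_set_def by blast
  have uniq: "i = j" if v: "v = i \<or> (v, i) \<in> parcs G" "v = j \<or> (v, j) \<in> parcs G"
    and ij: "i \<in> S" "j \<in> S" for v i j
  proof (rule ccontr)
    assume "i \<noteq> j"
    define f where "f k = (if (k, v) \<in> parcs G then v else SOME w. (k, w) \<in> parcs G)" for k
    have f: "(k, f k) \<in> parcs G" if "k \<in> S" for k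
      using nb[of k] that sub someI_ex[of "\<lambda>w. (k, w) \<in> parcs G"] unfolding f_def by auto
    have "2 * card S \<le> card (S \<union> f ` S)"
      using le total_dominating_set_Un_neighbours[OF dom f] by blast
    then have "card (f ` S) = card S" and disj: "card (S \<inter> f ` S) = 0"
      using card_Un_Int[OF fin finite_imageI[OF fin, of f]] card_image_le[OF fin, of f] by linarith+
    then have inj: "inj_on f S" using fin eq_card_imp_inj_on by blast
    have disj: "S \<inter> f ` S = {}" using disj fin by simp
    have fv: "f k = v" if "(v, k) \<in> parcs G" for k
      using that arcs_symmetric unfolding f_def by auto
    show False
    proof (cases "v \<in> S")
      case True
      \<comment> \<open>At least one of \<open>i\<close>, \<open>j\<close> differs from
        \<open>v\<close>; it is adjacent to \<open>v\<close>, hence mapped to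
        \<open>v\<close>.\<close>
      moreover have "v \<in> f ` S" using v ij \<open>i \<noteq> j\<close> fv by (metis imageI)
      ultimately show False using disj by blast
    next
      case False
      then have "f i = f j" using v ij fv by metis
      then show False using inj ij \<open>i \<noteq> j\<close> by (simp add: inj_on_eq_iff)
    qed
  qed
  show ?thesis
    unfolding efficient_dominating_set_def
  proof (intro conjI ballI)
    fix v assume "v \<in> pverts G"
    then obtain u where "u \<in> S" "v = u \<or> (v, u) \<in> parcs G"
      using dom unfolding dominating_set_def by blast
    then show "\<exists>!u. u \<in> S \<and> (v = u \<or> (v, u) \<in> parcs G)"
      using uniq by blast
  qed (fact sub)
qed

end

section \<open>Transversals of the factors in the lexicographic product\<close>

locale lex_factors = pair_graph G
  for G :: "'i pair_pre_digraph" +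
  fixes F :: "'i \<Rightarrow> 'a pair_pre_digraph"
  assumes factor_graph: "i \<in> pverts G \<Longrightarrow> pair_graph (F i)"
    and factors_disjoint:
      "i \<in> pverts G \<Longrightarrow> j \<in> pverts G \<Longrightarrow> i \<noteq> j \<Longrightarrow> pverts (F i) \<inter> pverts (F j) = {}"
begin

abbreviation H :: "'a pair_pre_digraph" where "H \<equiv> lex_product G F"

lemma pair_graph_H: "pair_graph H"
  by (rule pair_graph_lex_product[OF pair_graph_axioms factor_graph factors_disjoint])

lemma adjacent_iff:
  assumes "i \<in> pverts G" "j \<in> pverts G" "x \<in> pverts (F i)" "y \<in> pverts (F j)" "i \<noteq> j"
  shows "(x, y) \<in> parcs H \<longleftrightarrow> (i, j) \<in> parcs G"
  using lex_product_adjacent_iff[OF pair_graph_axioms factor_graph factors_disjoint assms(1-4)] assms(5)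
  by simp

lemma adjacentI:
  assumes "(i, j) \<in> parcs G" "x \<in> pverts (F i)" "y \<in> pverts (F j)"
  shows "(x, y) \<in> parcs H"
  using assms by auto

text \<open>If \<open>D\<close> misses \<open>F i\<close>, a vertex of \<open>F i\<close> must be
  dominated from another factor, and arcs between different factors come from arcs of
  \<open>G\<close>.\<close>

lemma dominating_set_factor_indices:
  assumes dom: "dominating_set H D" and ne: "\<And>i. i \<in> pverts G \<Longrightarrow> pverts (F i) \<noteq> {}"
  shows "dominating_set G {i \<in> pverts G. D \<inter> pverts (F i) \<noteq> {}}"
  unfolding dominating_set_def
proof (intro conjI ballI)
  fix i assume i: "i \<in> pverts G - {i \<in> pverts G. D \<inter> pverts (F i) \<noteq> {}}"
  then obtain x where x: "x \<in> pverts (F i)" using ne by blast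
  with i have "x \<in> pverts H - D" by auto
  then obtain y where y: "y \<in> D" "(x, y) \<in> parcs H" using dom unfolding dominating_set_def by blast
  then obtain j where j: "j \<in> pverts G" "y \<in> pverts (F j)"
    using dom unfolding dominating_set_def by auto
  have "i \<noteq> j" using i j y by blast
  then have "(i, j) \<in> parcs G" using adjacent_iff[of i j x y] i j x y by blast
  then show "\<exists>j\<in>{i \<in> pverts G. D \<inter> pverts (F i) \<noteq> {}}. (i, j) \<in> parcs G" using j y by blast
qed blast

lemma inj_on_transversal:
  assumes "\<And>i. i \<in> pverts G \<Longrightarrow> c i \<in> pverts (F i)"
  shows "inj_on c (pverts G)"
  using assms factors_disjoint by (intro inj_onI) (metis IntI empty_iff)

text \<open>A neighbour \<open>j\<close> of \<open>i\<close> in \<open>T\<close> makes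
  \<open>c j\<close> adjacent to all of \<open>F i\<close>. Totality supplies such a
  \<open>j\<close> even when \<open>i\<close> lies in \<open>T\<close>, where \<open>c i\<close>
  alone could miss vertices of \<open>F i\<close>.\<close>

lemma total_dominating_set_transversal:
  assumes c: "\<And>i. i \<in> pverts G \<Longrightarrow> c i \<in> pverts (F i)" and T: "total_dominating_set G T"
  shows "total_dominating_set H (c ` T)"
  unfolding total_dominating_set_def
proof (intro conjI ballI)
  have sub: "T \<subseteq> pverts G" using T unfolding total_dominating_set_def by blast
  then show "c ` T \<subseteq> pverts H" using c by auto
  fix x assume "x \<in> pverts H"
  then obtain i where i: "i \<in> pverts G" "x \<in> pverts (F i)" by auto
  then obtain j where "j \<in> T" "(i, j) \<in> parcs G" using T unfolding total_dominating_set_def by blast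
  then show "\<exists>y\<in>c ` T. (x, y) \<in> parcs H" using adjacentI i c sub by blast
qed

text \<open>By disjointness of the factors, \<open>c i\<close> is the only vertex of
  \<open>F i\<close> that a transversal can contain.\<close>

lemma transversal_misses_factor_vertex:
  assumes c: "\<And>i. i \<in> pverts G \<Longrightarrow> c i \<in> pverts (F i)" and "T \<subseteq> pverts G"
    and i: "i \<in> pverts G" "card (pverts (F i)) \<ge> 2"
  shows "pverts (F i) - c ` T \<noteq> {}"
proof -
  have "pverts (F i) \<noteq> {c i}" using i(2) by auto
  then obtain x where x: "x \<in> pverts (F i)" "x \<noteq> c i" using c i(1) by blast
  have "x \<notin> c ` T"
    using x c i(1) factors_disjoint assms(2) by (metis IntI empty_iff imageE subsetD)
  with x show ?thesis by blast
qed

text \<open>Walks in \<open>G\<close> lift to \<open>W\<close> one factor at a time: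
  \<open>W\<close> has a vertex in each factor, and adjacent factors are completely joined.\<close>

lemma connected_induce_meeting_factors:
  assumes conn: "Digraph_Component.connected (with_proj G)" and "card (pverts G) \<ge> 2"
    and W: "W \<subseteq> pverts H" "\<And>i. i \<in> pverts G \<Longrightarrow> W \<inter> pverts (F i) \<noteq> {}"
  shows "Digraph_Component.connected (induce_subgraph (with_proj H) W)"
proof -
  interpret H: pair_graph H by (rule pair_graph_H)
  let ?K = "induce_subgraph (with_proj H) W"
  interpret K: wf_digraph ?K by (rule H.wellformed_induce_subgraph)
  have adj: "x \<rightarrow>\<^bsub>?K\<^esub> y"
    if "(i, j) \<in> parcs G" "x \<in> W" "y \<in> W" "x \<in> pverts (F i)" "y \<in> pverts (F j)" for i j x y
    using adjacentI that unfolding arcs_ends_induce_subgraph by blast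
  have reach: "\<exists>y\<in>W \<inter> pverts (F j). x \<rightarrow>\<^sup>*\<^bsub>?K\<^esub> y"
    if "i \<rightarrow>\<^sup>*\<^bsub>with_proj G\<^esub> j" "x \<in> W" "x \<in> pverts (F i)" for i j x
    using that(1)
  proof (induction rule: reachable_induct)
    case base
    have "x \<rightarrow>\<^sup>*\<^bsub>?K\<^esub> x" using that(2) by (intro K.reachable_refl) simp
    then show ?case using that(2,3) by blast
  next
    case (step k l)
    then obtain y where y: "y \<in> W \<inter> pverts (F k)" "x \<rightarrow>\<^sup>*\<^bsub>?K\<^esub> y" by blast
    obtain z where z: "z \<in> W \<inter> pverts (F l)" using W(2)[of l] step in_arcsD2 by blast
    then show ?case using K.reachable_adj_trans[OF y(2) adj] step y z by blast
  qed
  have "x \<rightarrow>\<^sup>*\<^bsub>?K\<^esub> y" if xy: "x \<in> W" "y \<in> W" for x y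
  proof -
    obtain i j where ij: "i \<in> pverts G" "x \<in> pverts (F i)" "j \<in> pverts G" "y \<in> pverts (F j)"
      using xy W(1) unfolding lex_product_simps(1) by blast
    \<comment> \<open>Entering \<open>F\<^sub>j\<close> from a neighbouring factor reaches all of its vertices, also when \<open>i = j\<close>.\<close>
    obtain k where k: "(j, k) \<in> parcs G" using connected_ex_neighbour assms(1,2) ij(3) by blast
    then have "k \<in> pverts G" by (rule in_arcsD2)
    then have "i \<rightarrow>\<^sup>*\<^bsub>with_proj G\<^esub> k" using conn ij(1) connected_iff_reachable by blast
    then obtain z where z: "z \<in> W \<inter> pverts (F k)" "x \<rightarrow>\<^sup>*\<^bsub>?K\<^esub> z"
      using reach xy ij by blast
    have "(k, j) \<in> parcs G" using k arcs_symmetric by blast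
    then show ?thesis using K.reachable_adj_trans[OF z(2) adj] z xy ij by blast
  qed
  moreover have "W \<noteq> {}" using W(2) conn connected_iff_reachable by blast
  ultimately have "strongly_connected ?K" by (intro strongly_connectedI) auto
  moreover have "symmetric ?K"
    unfolding symmetric_def arcs_ends_induce_subgraph using H.arcs_symmetric by (intro symI) blast
  ultimately show ?thesis
    unfolding Digraph_Component.connected_def strongly_connected_def
    using K.reachable_mk_symmetric_eq by simp
qed

text \<open>Each vertex is joined to all of some neighbouring factor, which keeps a vertex outside
  the transversal.\<close>

lemma transversal_total_restrained:
  assumes c: "\<And>i. i \<in> pverts G \<Longrightarrow> c i \<in> pverts (F i)" and T: "total_dominating_set G T"
    and big: "\<And>i. i \<in> pverts G \<Longrightarrow> card (pverts (F i)) \<ge> 2"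
  shows "total_restrained_dominating_set H (c ` T)"
proof -
  have sub: "T \<subseteq> pverts G" using T unfolding total_dominating_set_def by blast
  have "\<exists>y \<in> pverts H - c ` T. (x, y) \<in> parcs H" if "x \<in> pverts H - c ` T" for x
  proof -
    obtain i where i: "i \<in> pverts G" "x \<in> pverts (F i)" using \<open>x \<in> pverts H - c ` T\<close> by auto
    then obtain j where j: "j \<in> pverts G" "(i, j) \<in> parcs G"
      using T sub unfolding total_dominating_set_def by blast
    obtain y where y: "y \<in> pverts (F j) - c ` T"
      using transversal_misses_factor_vertex[OF c sub j(1) big[OF j(1)]] by blast
    then have "(x, y) \<in> parcs H" using adjacentI[OF j(2) i(2)] by blast
    moreover have "y \<in> pverts H - c ` T" using j(1) y by auto
    ultimately show ?thesis by blast
  qed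
  then show ?thesis
    using total_dominating_set_transversal[OF c T] total_dominating_imp_dominating
    unfolding total_restrained_dominating_set_def restrained_dominating_set_def by blast
qed

lemma transversal_total_outer_connected:
  assumes "Digraph_Component.connected (with_proj G)" "card (pverts G) \<ge> 2"
    and c: "\<And>i. i \<in> pverts G \<Longrightarrow> c i \<in> pverts (F i)" and T: "total_dominating_set G T"
    and big: "\<And>i. i \<in> pverts G \<Longrightarrow> card (pverts (F i)) \<ge> 2"
  shows "total_outer_connected_dominating_set H (c ` T)"
proof -
  have sub: "T \<subseteq> pverts G" using T unfolding total_dominating_set_def by blast
  have "(pverts H - c ` T) \<inter> pverts (F i) \<noteq> {}" if i: "i \<in> pverts G" for i
    using transversal_misses_factor_vertex[OF c sub i big[OF i]] i by auto
  then have "Digraph_Component.connected (induce_subgraph (with_proj H) (pverts H - c ` T))"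
    using connected_induce_meeting_factors[OF assms(1,2)] by blast
  then show ?thesis
    using total_dominating_set_transversal[OF c T] total_dominating_imp_dominating
    unfolding total_outer_connected_dominating_set_def outer_connected_dominating_set_def by blast
qed

text \<open>The matching joins \<open>c i\<close> to \<open>c (f i)\<close>. As \<open>c\<close> is
  injective on the indices, injectivity of \<open>f\<close> and disjointness of \<open>S\<close>
  from its image carry over to \<open>H\<close>.\<close>

lemma transversal_paired:
  assumes c: "\<And>i. i \<in> pverts G \<Longrightarrow> c i \<in> pverts (F i)" and S: "dominating_set G S"
    and f: "\<And>i. i \<in> S \<Longrightarrow> (i, f i) \<in> parcs G" "inj_on f S" "S \<inter> f ` S = {}"
  shows "paired_dominating_set H (c ` (S \<union> f ` S))"
proof -
  have sub: "S \<subseteq> pverts G" "f ` S \<subseteq> pverts G"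
    using S f(1) in_arcsD2 unfolding dominating_set_def by blast+
  note inj = inj_on_transversal[OF c]
  have "inj_on (c \<circ> f) S" using f(2) inj sub(2) by (blast intro: comp_inj_on inj_on_subset)
  moreover have "c ` S \<inter> (c \<circ> f) ` S = {}"
    using inj_on_image_Int[OF inj sub] f(3) by (simp add: image_comp)
  moreover have "(c i, (c \<circ> f) i) \<in> parcs H" if "i \<in> S" for i
    using adjacentI[OF f(1)[OF that]] c sub that by (simp add: subset_iff)
  ultimately have "perfect_matching (induce_subgraph (with_proj H) (c ` S \<union> (c \<circ> f) ` S))
      ((\<lambda>i. {c i, (c \<circ> f) i}) ` S)"
    using inj_on_subset[OF inj sub(1)] by (intro perfect_matching_images)
  then have "\<exists>M. perfect_matching (induce_subgraph (with_proj H) (c ` (S \<union> f ` S))) M"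
    by (auto simp: image_Un image_comp)
  moreover have "dominating_set H (c ` (S \<union> f ` S))"
    using total_dominating_set_Un_neighbours[OF S f(1)] total_dominating_set_transversal[OF c]
      total_dominating_imp_dominating by blast
  ultimately show ?thesis unfolding paired_dominating_set_def by blast
qed

end

section \<open>Comparison of all parameters with \<open>card D\<close>\<close>

theorem theorem2p10:
  fixes n :: nat
    and G :: "nat pair_pre_digraph"
    and F :: "nat \<Rightarrow> 'a pair_pre_digraph"
    and D :: "'a set"
    and I :: "nat set"
  assumes "n \<ge> 2"
    and "pair_graph G" and "pverts G = {1..n}"
    and "Digraph_Component.connected (with_proj G)"
    and "\<And>i. i \<in> {1..n} \<Longrightarrow> pair_graph (F i)"
    and "\<And>i j. i \<in> {1..n} \<Longrightarrow> j \<in> {1..n} \<Longrightarrow> i \<noteq> j \<Longrightarrow> pverts (F i) \<inter> pverts (F j) = {}"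
    and "minimum_dominating_set (lex_product G F) D"
    and "\<And>i. i \<in> {1..n} \<Longrightarrow> card (pverts (F i)) \<ge> 2 \<and> card (D \<inter> pverts (F i)) \<noteq> 1"
    and "I = {i \<in> {1..n}. D \<inter> pverts (F i) \<noteq> {}}"
  shows "(\<forall>i\<in>I. card (D \<inter> pverts (F i)) = 2) \<and>
    efficient_dominating_set G I \<and>
    2 * \<gamma> G = \<gamma>\<^sub>t G \<and>
    \<gamma>\<^sub>t G = \<gamma> (lex_product G F) \<and>
    \<gamma> (lex_product G F) = \<gamma>\<^sub>r (lex_product G F) \<and>
    \<gamma>\<^sub>r (lex_product G F) = \<gamma>\<^sub>t (lex_product G F) \<and>
    \<gamma>\<^sub>t (lex_product G F) = \<gamma>\<^sub>t\<^sub>r (lex_product G F) \<and>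
    \<gamma>\<^sub>t\<^sub>r (lex_product G F) = \<gamma>\<^sup>o\<^sup>c (lex_product G F) \<and>
    \<gamma>\<^sup>o\<^sup>c (lex_product G F) = \<gamma>\<^sub>t\<^sup>o\<^sup>c (lex_product G F) \<and>
    \<gamma>\<^sub>t\<^sup>o\<^sup>c (lex_product G F) = \<gamma>\<^sub>p (lex_product G F)"
proof -
  interpret lex_factors G F
    using assms(2,3,5,6) by (intro lex_factors.intro lex_factors_axioms.intro) auto
  have conn: "Digraph_Component.connected (with_proj G)" and cardG: "card (pverts G) \<ge> 2"
    using assms(1,3,4) by auto
  have big: "card (pverts (F i)) \<ge> 2" if "i \<in> pverts G" for i using assms(3,8) that by blast
  then have ne: "pverts (F i) \<noteq> {}" if "i \<in> pverts G" for i using that by fastforce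
  define c where "c i = (SOME x. x \<in> pverts (F i))" for i
  have c: "c i \<in> pverts (F i)" if "i \<in> pverts G" for i
    using ne[OF that] unfolding c_def by (simp add: some_in_eq)
  have nb: "\<exists>w. (v, w) \<in> parcs G" if "v \<in> pverts G" for v
    using connected_ex_neighbour[OF conn cardG that] .
  define f where "f v = (SOME w. (v, w) \<in> parcs G)" for v
  have f: "(v, f v) \<in> parcs G" if "v \<in> pverts G" for v
    using nb[OF that] unfolding f_def by (rule someI_ex)
  have domD: "dominating_set H D" and minD: "enat (card D) = min_card (dominating_set H)"
    using assms(7) unfolding minimum_dominating_set_def domination_number_def by auto
  have D_le: "card D \<le> card S" if "dominating_set H S" for S
    using min_card_le[of "dominating_set H", OF that] unfolding minD[symmetric] by simp
  have I: "I = {i \<in> pverts G. D \<inter> pverts (F i) \<noteq> {}}" using assms(3,9) by simp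
  have domI: "dominating_set G I" unfolding I by (rule dominating_set_factor_indices[OF domD ne])
  have finI: "finite I" using assms(9) by simp
  have finD: "finite D"
    using domD pair_fin_digraph.pair_finite_verts[of H] pair_graph_H finite_subset
    unfolding dominating_set_def pair_graph_def pair_digraph_def by blast
  have subI: "I \<subseteq> pverts G" unfolding I by blast
  have "D = (\<Union>i\<in>I. D \<inter> pverts (F i))"
    using domD unfolding I dominating_set_def lex_product_simps(1) by blast
  then have cardD: "card D = (\<Sum>i\<in>I. card (D \<inter> pverts (F i)))"
    using card_UN_disjoint[of I "\<lambda>i. D \<inter> pverts (F i)"] finI finD factors_disjoint subI by fastforce
  have two_le: "2 \<le> card (D \<inter> pverts (F i))" if "i \<in> I" for i
  proof -
    \<comment> \<open>Membership in \<open>I\<close> excludes 0 and the hypothesis on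
      \<open>D\<close> excludes 1.\<close>
    have "card (D \<inter> pverts (F i)) \<noteq> 0" using that finD unfolding I by auto
    moreover have "card (D \<inter> pverts (F i)) \<noteq> 1" using that assms(8,9) by blast
    ultimately show ?thesis by linarith
  qed
  have I_le_D: "2 * card I \<le> card D"
    using sum_mono[of I "\<lambda>_. 2", OF two_le] unfolding cardD by (simp add: mult.commute)

  have total_le: "card D \<le> card T" if T: "total_dominating_set G T" for T
  proof -
    have "card D \<le> card (c ` T)"
      using D_le total_dominating_imp_dominating total_dominating_set_transversal[OF c T] by blast
    also have "\<dots> \<le> card T"
      using T pair_finite_verts finite_subset card_image_le unfolding total_dominating_set_def by blast
    finally show ?thesis .
  qed
  have dom_le: "card D \<le> 2 * card S" if S: "dominating_set G S" for S
  proof -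
    have sub: "S \<subseteq> pverts G" using S unfolding dominating_set_def by blast
    then have "finite S" using pair_finite_verts finite_subset by blast
    have "card D \<le> card (S \<union> f ` S)"
      using total_le total_dominating_set_Un_neighbours[OF S] f sub by blast
    also have "\<dots> \<le> card S + card (f ` S)" by (rule card_Un_le)
    also have "\<dots> \<le> 2 * card S" using card_image_le[OF \<open>finite S\<close>, of f] by simp
    finally show ?thesis .
  qed
  \<comment> \<open>Taking \<open>S = I\<close> in \<open>dom_le\<close> closes the chain of
    inequalities.\<close>
  have eq: "card D = 2 * card I" using dom_le[OF domI] I_le_D by simp

  have two: "\<forall>i\<in>I. card (D \<inter> pverts (F i)) = 2"
  proof (rule ccontr)
    assume "\<not> ?thesis"
    then obtain i where i: "i \<in> I" "2 < card (D \<inter> pverts (F i))" using two_le by fastforce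
    \<comment> \<open>All summands are at least 2, so a single larger one would push
      \<open>card D\<close> above \<open>2 * card I\<close>.\<close>
    then have "(\<Sum>i\<in>I. 2) < (\<Sum>i\<in>I. card (D \<inter> pverts (F i)))"
      using finI two_le by (intro sum_strict_mono_ex1) auto
    then show False using eq cardD by simp
  qed
  have eff: "efficient_dominating_set G I"
    using efficient_dominating_setI[OF domI finI nb] total_le unfolding eq by blast

  define T where "T = I \<union> f ` I"
  have T: "total_dominating_set G T"
    unfolding T_def using total_dominating_set_Un_neighbours[OF domI] f subI by blast
  have "card T = card I + card (f ` I) - card (I \<inter> f ` I)"
    using card_Un_Int[of I "f ` I"] finI unfolding T_def by simp
  moreover have "card (f ` I) \<le> card I" using finI by (rule card_image_le)
  \<comment> \<open>This bound keeps the truncated subtraction in the formula for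
    \<open>card T\<close> exact.\<close>
  moreover have "card (I \<inter> f ` I) \<le> card I" using finI by (simp add: card_mono)
  ultimately have cardT: "card T = card D" and cf: "card (f ` I) = card I" and "card (I \<inter> f ` I) = 0"
    using total_le[OF T] eq by linarith+
  then have inj: "inj_on f I" and disj: "I \<inter> f ` I = {}"
    using finI eq_card_imp_inj_on by auto
  have cardS: "card (c ` T) = card D"
    using cardT card_image inj_on_subset[OF inj_on_transversal[OF c]] T
    unfolding total_dominating_set_def by metis
  have tr: "total_restrained_dominating_set H (c ` T)"
    by (rule transversal_total_restrained[OF c T big])
  have toc: "total_outer_connected_dominating_set H (c ` T)"
    by (rule transversal_total_outer_connected[OF conn cardG c T big])
  have pd: "paired_dominating_set H (c ` T)"
    unfolding T_def using transversal_paired[OF c domI] f subI inj disj by blast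
  \<comment> \<open>\<open>D\<close> is minimum among dominating sets and \<open>c\<close>
    T\<open>has the same size, so\<close>c \<open>T\<close> is optimal for any stronger property
    that it satisfies.\<close>
  have num: "min_card P = enat (card D)"
    if "P (c ` T)" "\<And>S. P S \<Longrightarrow> dominating_set H S" for P
    using min_card_eqI[of P "c ` T"] that D_le unfolding cardS by blast
  note defs = total_restrained_dominating_set_def restrained_dominating_set_def
    total_outer_connected_dominating_set_def outer_connected_dominating_set_def
    paired_dominating_set_def
  \<comment> \<open>\<open>I\<close> is itself minimum:
    \<open>2 * card I = card D \<le> 2 * card S\<close> for every dominating set \<open>S\<close> of
    \<open>G\<close>.\<close>
  have g: "\<gamma> G = enat (card I)"
    unfolding domination_number_def using dom_le eq domI by (intro min_card_eqI) auto
  have gt: "\<gamma>\<^sub>t G = enat (card D)"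
    unfolding total_domination_number_def
    using min_card_eqI[of "total_dominating_set G" T] T total_le cardT by simp
  have "2 * \<gamma> G = \<gamma>\<^sub>t G"
    unfolding g gt eq by (simp add: numeral_eq_enat)
  moreover have "\<gamma> H = enat (card D)" unfolding domination_number_def using minD by simp
  moreover have "\<gamma>\<^sub>r H = enat (card D)"
    unfolding restrained_domination_number_def by (rule num) (use tr in \<open>auto simp only: defs\<close>)
  moreover have "\<gamma>\<^sub>t H = enat (card D)"
    unfolding total_domination_number_def
    by (rule num) (use tr total_dominating_imp_dominating in \<open>auto simp only: defs\<close>)
  moreover have "\<gamma>\<^sub>t\<^sub>r H = enat (card D)"
    unfolding total_restrained_domination_number_def
    by (rule num) (use tr in \<open>auto simp only: defs\<close>)
  moreover have "\<gamma>\<^sup>o\<^sup>c H = enat (card D)"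
    unfolding outer_connected_domination_number_def
    by (rule num) (use toc in \<open>auto simp only: defs\<close>)
  moreover have "\<gamma>\<^sub>t\<^sup>o\<^sup>c H = enat (card D)"
    unfolding total_outer_connected_domination_number_def
    by (rule num) (use toc in \<open>auto simp only: defs\<close>)
  moreover have "\<gamma>\<^sub>p H = enat (card D)"
    unfolding paired_domination_number_def by (rule num) (use pd in \<open>auto simp only: defs\<close>)
  ultimately show ?thesis using two eff gt by simp
qed

end
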